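(* Let $n\geq 2$ be a positive integer, let $Q$ and $R$ be commutative rings such that $\mathrm{char}(Q)>n!$, and let $P$ be a subring of $Q$. Let further $T\colon P\to Q$ and $A\colon P\to R$ be additive mappings for which \[ T(f^{n})= nf^{n-1}T(f)+nB\bigl(A(f), A(f^{n-1})\bigr) \] holds for all $f\in P$ with a symmetric and bi-additive mapping $B\colon R\times R\to Q$. If $n=2$ or $A(1)=0$, then \[ T(f\cdot g)= fT(g)+T(f)g+2B\bigl(A(f), A(g)\bigr) \] is satisfied for all $f,g\in P$.
   Context: Here $\mathrm{char}(Q)$ denotes the characteristic of the ring $Q$. A mapping between rings is additive if it is a homomorphism of the additive structures; $B\colon R\times R\to Q$ is bi-additive if it is additive in each variable separately, and symmetric if $B(u,v)=B(v,u)$ for all $u,v\in R$. In the alternative hypothesis $A(1)=0$, the symbol $1$ denotes the multiplicative identity, so this alternative presupposes that the identity exists and belongs to $P$; the alternative $n=2$ involves no such requirement.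
   Formalization: Added hypothesis: n!·x = 0 implies x = 0 in Q, as char(Q) > n! (with char 0 also allowed) is not enough: for n = 2, P = Q = (Z/4)[x,y], A = B = 0 and T(f) = 2·(coefficient of xy in f), the claim fails. It is automatic for prime char > n!. *)

theory Defs
  imports Complex_Main "HOL-Computational_Algebra.Primes"
begin

text \<open>
  Rings are not assumed to be unital, so the type class is \<open>comm_ring\<close>, which has neither
  \<open>1\<close> nor \<open>of_nat\<close> nor \<open>_ ^ _\<close> nor \<open>CHAR(_)\<close>.
  The first three definitions replace the last three of these.
\<close>

definition nmul :: "nat \<Rightarrow> 'a::comm_monoid_add \<Rightarrow> 'a" where
  "nmul k x = (\<Sum>i<k. x)"

text \<open>Only positive exponents are meaningful; \<open>spow x 0 = x\<close> is a junk value.\<close>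

definition spow :: "'a::semigroup_mult \<Rightarrow> nat \<Rightarrow> 'a" where
  "spow x k = (((*) x) ^^ (k - 1)) x"

definition ring_char :: "'a::comm_ring itself \<Rightarrow> nat" where
  "ring_char _ =
     (if \<exists>k>0. \<forall>x::'a. nmul k x = 0 then LEAST k. k > 0 \<and> (\<forall>x::'a. nmul k x = 0) else 0)"

definition torsion_free :: "nat \<Rightarrow> 'a::comm_monoid_add itself \<Rightarrow> bool" where
  "torsion_free m _ \<longleftrightarrow> (\<forall>x::'a. nmul m x = 0 \<longrightarrow> x = 0)"

text \<open>A subring need not contain an identity, even if the ambient ring has one.\<close>

definition is_subring :: "'a::comm_ring set \<Rightarrow> bool" where
  "is_subring P \<longleftrightarrow> 0 \<in> P \<and> (\<forall>x\<in>P. \<forall>y\<in>P. x - y \<in> P \<and> x * y \<in> P)"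

definition additive_on :: "'a::ab_group_add set \<Rightarrow> ('a \<Rightarrow> 'b::ab_group_add) \<Rightarrow> bool" where
  "additive_on P f \<longleftrightarrow> (\<forall>x\<in>P. \<forall>y\<in>P. f (x + y) = f x + f y)"

definition biadditive :: "('a::ab_group_add \<Rightarrow> 'a \<Rightarrow> 'b::ab_group_add) \<Rightarrow> bool" where
  "biadditive B \<longleftrightarrow> (\<forall>v. Modules.additive (\<lambda>u. B u v)) \<and> (\<forall>u. Modules.additive (\<lambda>v. B u v))"

lemma nmul_0 [simp]: "nmul 0 x = 0"
  by (simp add: nmul_def)

lemma nmul_Suc [simp]: "nmul (Suc k) x = nmul k x + x"
  by (simp add: nmul_def add.commute)

lemma nmul_eq_of_nat: "nmul k (x::'a::comm_semiring_1) = of_nat k * x"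
  by (induction k) (simp_all add: algebra_simps)

lemma spow_eq_power: "k > 0 \<Longrightarrow> spow (x::'a::comm_monoid_mult) k = x ^ k"
proof (induction k)
  case (Suc k)
  then show ?case by (cases k) (simp_all add: spow_def)
qed simp

lemma additive_on_UNIV: "additive_on UNIV f \<longleftrightarrow> Modules.additive f"
  by (auto simp: additive_on_def Modules.additive_def)

lemma ring_char_eq_CHAR: "ring_char TYPE('a::comm_ring_1) = CHAR('a)"
proof -
  have ann: "(\<forall>x::'a. nmul k x = 0) \<longleftrightarrow> CHAR('a) dvd k" for k
    by (metis nmul_eq_of_nat mult_1_right mult_zero_left of_nat_eq_0_iff_char_dvd)
  show ?thesis
  proof (cases "CHAR('a) = 0")
    case True
    then show ?thesis by (auto simp: ring_char_def ann)
  next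
    case False
    then have "(LEAST k. k > 0 \<and> CHAR('a) dvd k) = CHAR('a)"
      by (intro Least_equality) (auto intro: dvd_imp_le)
    with False show ?thesis by (auto simp: ring_char_def ann)
  qed
qed

lemma nmul_add: "nmul (j + k) x = nmul j x + nmul k x"
  by (induction k) (simp_all add: ac_simps)

lemma nmul_mult: "nmul (j * k) x = nmul j (nmul k x)"
  by (induction j) (simp_all add: nmul_add ac_simps)

lemma nmul_zero [simp]: "nmul k 0 = 0"
  by (induction k) simp_all

text \<open>
  A characteristic above \<open>n!\<close> does not by itself allow cancelling \<open>n!\<close>: a ring of
  characteristic 4 > 2! may have 2-torsion. For prime characteristic it does.
\<close>

lemma torsion_free_fact_if_prime_char:
  assumes "prime (ring_char TYPE('a::comm_ring))" "ring_char TYPE('a) > fact n"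
  shows "torsion_free (fact n) TYPE('a)"
  unfolding torsion_free_def
proof (intro allI impI)
  fix x :: 'a
  assume x: "nmul (fact n) x = 0"
  define p where "p = ring_char TYPE('a)"
  have ex: "\<exists>k>0. \<forall>x::'a. nmul k x = 0"
    using assms(1) by (auto simp: ring_char_def split: if_splits)
  have "p = (LEAST k. k > 0 \<and> (\<forall>x::'a. nmul k x = 0))"
    using ex by (simp add: p_def ring_char_def)
  then have px: "nmul p x = 0"
    using LeastI_ex[OF ex] by simp
  have "coprime p (fact n)"
    using assms by (auto simp: p_def intro!: prime_imp_coprime dest: dvd_imp_le)
  then obtain a b where "fact n * a = p * b + 1"
    using bezout_nat[of "fact n" p] by (auto simp: coprime_iff_gcd_eq_1 gcd.commute)
  then have "nmul (a * fact n) x = nmul (b * p) x + x"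
    by (simp add: mult.commute)
  then show "x = 0"
    by (simp add: nmul_mult x px)
qed

end

theory Submission
  imports Defs
begin

text \<open>
  For \<open>n = 2\<close> the identity is polarized. Otherwise let \<open>e\<close> be the identity; since \<open>A e = 0\<close>,
  putting \<open>f = e\<close> gives \<open>T e = 0\<close>. Replace \<open>f\<close> by \<open>f + k e\<close> with \<open>k\<close> a natural number and expand
  both sides in powers of \<open>k\<close>. The terms of degree \<open>n\<close> and \<open>n - 1\<close> cancel, so comparing the
  coefficients of \<open>k ^ (n - 2)\<close>, which are now the leading ones, yields the case \<open>n = 2\<close> for \<open>f\<close>.
\<close>

section \<open>Multiples, subrings and additive maps\<close>

lemma nmul_add_right: "nmul k (x + y) = nmul k x + nmul k y"
  by (simp add: nmul_def sum.distrib)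

lemma nmul_diff_right: "nmul k (x - y) = nmul k x - nmul k (y::'a::ab_group_add)"
  by (simp add: nmul_def sum_subtractf)

lemma nmul_sum_right: "nmul k (sum g I) = (\<Sum>i\<in>I. nmul k (g i))"
  unfolding nmul_def by (rule sum.swap)

lemma nmul_sum_left: "nmul (sum g I) x = (\<Sum>i\<in>I. nmul (g i) x)"
  by (induction I rule: infinite_finite_induct) (simp_all add: nmul_add)

lemma nmul_mult_left: "nmul k x * y = nmul k (x * (y::'a::comm_ring))"
  by (simp add: nmul_def sum_distrib_right)

lemma mult_nmul_right: "x * nmul k y = nmul k (x * (y::'a::comm_ring))"
  by (simp add: nmul_def sum_distrib_left)

lemma nmul_1 [simp]: "nmul 1 x = x"
  by (simp add: nmul_def)

text \<open>Lets the single assumption on n! cancel 2, n - 1 and n! itself, since all three divide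
  n!.\<close>

lemma torsion_freeD:
  assumes "torsion_free m TYPE('a::comm_monoid_add)" "d dvd m" "nmul d (x::'a) = 0"
  shows "x = 0"
proof -
  obtain c where "m = c * d"
    using assms(2) by (auto simp: dvd_def mult.commute)
  then have "nmul m x = 0"
    by (simp add: nmul_mult assms(3))
  with assms(1) show ?thesis
    by (simp add: torsion_free_def)
qed

lemma subring_closed:
  assumes "is_subring P"
  shows "0 \<in> P"
    and "x \<in> P \<Longrightarrow> y \<in> P \<Longrightarrow> x - y \<in> P"
    and "x \<in> P \<Longrightarrow> y \<in> P \<Longrightarrow> x * y \<in> P"
    and "x \<in> P \<Longrightarrow> y \<in> P \<Longrightarrow> x + y \<in> P"
proof -
  show zero: "0 \<in> P"
    using assms by (simp add: is_subring_def)
  show diff: "x - y \<in> P" if "x \<in> P" "y \<in> P" for x y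
    using assms that by (simp add: is_subring_def)
  show "x \<in> P \<Longrightarrow> y \<in> P \<Longrightarrow> x * y \<in> P"
    using assms by (auto simp: is_subring_def)
  show "x + y \<in> P" if "x \<in> P" "y \<in> P"
    using diff[OF that(1) diff[OF zero that(2)]] by simp
qed

lemma subring_sum_closed:
  assumes "is_subring P" "\<And>i. i \<in> I \<Longrightarrow> g i \<in> P"
  shows "sum g I \<in> P"
  using assms(2)
  by (induction I rule: infinite_finite_induct) (auto intro: subring_closed[OF assms(1)])

lemma subring_nmul_closed:
  assumes "is_subring P" "x \<in> P"
  shows "nmul k x \<in> P"
  unfolding nmul_def using assms by (intro subring_sum_closed)

lemma additive_on_zero:
  assumes "is_subring P" "additive_on P h"
  shows "h 0 = 0"
proof -
  have "h (0 + 0) = h 0 + h 0"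
    using assms subring_closed(1) unfolding additive_on_def by blast
  then show ?thesis by simp
qed

lemma additive_on_sum:
  assumes "is_subring P" "additive_on P h" "\<And>i. i \<in> I \<Longrightarrow> g i \<in> P"
  shows "h (sum g I) = (\<Sum>i\<in>I. h (g i))"
  using assms(3)
proof (induction I rule: infinite_finite_induct)
  case (insert i I)
  have "h (g i + sum g I) = h (g i) + h (sum g I)"
    using assms(2) insert.prems subring_sum_closed[OF assms(1), of I g]
    unfolding additive_on_def by blast
  with insert show ?case by simp
qed (simp_all add: additive_on_zero[OF assms(1,2)])

lemma additive_on_nmul:
  assumes "is_subring P" "additive_on P h" "x \<in> P"
  shows "h (nmul k x) = nmul k (h x)"
  unfolding nmul_def using assms by (intro additive_on_sum)

lemma additive_on_sum_nmul:
  assumes "is_subring P" "additive_on P h" "\<And>i. p i \<in> P"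
  shows "h (\<Sum>i\<in>I. nmul (a i) (p i)) = (\<Sum>i\<in>I. nmul (a i) (h (p i)))"
  using assms by (simp add: additive_on_sum additive_on_nmul subring_nmul_closed)

lemma is_subring_UNIV: "is_subring UNIV"
  by (simp add: is_subring_def)

section \<open>Polynomials in a natural number variable\<close>

text \<open>Taking differences in \<open>k\<close> lowers the degree by one.\<close>

lemma nmul_fact_leading_coeff_eq_0:
  fixes d :: "nat \<Rightarrow> 'a::ab_group_add"
  assumes "\<And>k. (\<Sum>j\<le>m. nmul (k ^ j) (d j)) = 0"
  shows "nmul (fact m) (d m) = 0"
  using assms
proof (induction m arbitrary: d)
  case 0
  from "0.prems"[of 0] show ?case by simp
next
  case (Suc m)
  \<comment> \<open>\<open>d' i\<close> is the coefficient of \<open>k ^ i\<close> in the difference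
    of the values at \<open>k + 1\<close> and \<open>k\<close> of the polynomial with coefficients
    \<open>d\<close>.\<close>
  define d' where "d' i = (\<Sum>j\<in>{i<..Suc m}. nmul (j choose i) (d j))" for i
  have "(\<Sum>i\<le>m. nmul (k ^ i) (d' i)) = 0" for k
  proof -
    have expand: "nmul (Suc k ^ j) x = nmul (k ^ j) x + (\<Sum>i<j. nmul (k ^ i) (nmul (j choose i) x))"
      for j and x :: 'a
    proof -
      have "Suc k ^ j = (\<Sum>i\<le>j. (j choose i) * k ^ i)"
        using binomial[of k 1 j] by simp
      also have "\<dots> = k ^ j + (\<Sum>i<j. k ^ i * (j choose i))"
        by (simp add: lessThan_Suc_atMost[symmetric] mult.commute)
      finally show ?thesis
        by (simp add: nmul_add nmul_sum_left nmul_mult)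
    qed
    have "(\<Sum>i\<le>m. nmul (k ^ i) (d' i))
        = (\<Sum>i\<le>m. \<Sum>j\<in>{i<..Suc m}. nmul (k ^ i) (nmul (j choose i) (d j)))"
      by (simp add: d'_def nmul_sum_right)
    \<comment> \<open>The order of summation over the triangle \<open>i < j \<le> Suc m\<close> is
      exchanged.\<close>
    also have "\<dots> = (\<Sum>j\<le>Suc m. \<Sum>i<j. nmul (k ^ i) (nmul (j choose i) (d j)))"
      by (subst (1 2) sum.Sigma, simp_all del: sum.atMost_Suc)
        (rule sum.reindex_bij_witness[of _ prod.swap prod.swap], auto)
    also have "\<dots> = (\<Sum>j\<le>Suc m. nmul (Suc k ^ j) (d j)) - (\<Sum>j\<le>Suc m. nmul (k ^ j) (d j))"
      unfolding expand sum.distrib by simp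
    also have "\<dots> = 0"
      by (simp only: Suc.prems diff_self)
    finally show ?thesis .
  qed
  then have "nmul (fact m) (d' m) = 0"
    by (rule Suc.IH)
  \<comment> \<open>The new leading coefficient carries the factor \<open>Suc m\<close>; these
    factors build up the factorial.\<close>
  moreover have "d' m = nmul (Suc m) (d (Suc m))"
  proof -
    have "{m<..Suc m} = {Suc m}" by auto
    then show ?thesis by (simp add: d'_def del: nmul_Suc)
  qed
  ultimately show ?case
    by (simp add: nmul_mult[symmetric] mult.commute del: nmul_Suc)
qed

section \<open>Powers relative to an identity element\<close>

text \<open>The iterate has the proper value \<open>e\<close> at exponent 0, where
  \<open>spow\<close> is junk, so binomial sums can start at index 0.\<close>

lemma spow_eq_funpow:
  assumes "\<And>x::'a::comm_ring. e * x = x" "j > 0"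
  shows "spow f j = (((*) f) ^^ j) e"
proof -
  obtain i where "j = Suc i"
    using assms(2) by (cases j) auto
  moreover have "f * e = f"
    using assms(1)[of f] by (simp add: mult.commute)
  ultimately show ?thesis
    by (simp add: spow_def funpow_swap1)
qed

text \<open>The binomial theorem, by Pascal's rule, with the identity given as an element
  \<open>e\<close>.\<close>

lemma funpow_mult_binomial:
  assumes e: "\<And>x::'a::comm_ring. e * x = x"
  shows "(((*) (f + nmul k e)) ^^ j) e
    = (\<Sum>i\<le>j. nmul ((j choose i) * k ^ (j - i)) ((((*) f) ^^ i) e))"
proof (induction j)
  case 0
  show ?case by simp
next
  case (Suc j)
  define p where "p i = (((*) f) ^^ i) e" for i
  \<comment> \<open>This sum comes from the factor \<open>nmul k e\<close>. It is reindexed to match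
    the one from \<open>f\<close>; the index \<open>Suc j\<close> may be added because its binomial
    coefficient is 0.\<close>
  have shift: "(\<Sum>i\<le>j. nmul ((j choose i) * k ^ (Suc j - i)) (p i))
      = nmul (k ^ Suc j) (p 0) + (\<Sum>i\<le>j. nmul ((j choose Suc i) * k ^ (j - i)) (p (Suc i)))"
  proof -
    have "(\<Sum>i\<le>j. nmul ((j choose i) * k ^ (Suc j - i)) (p i))
        = (\<Sum>i\<le>Suc j. nmul ((j choose i) * k ^ (Suc j - i)) (p i))"
      by (simp add: binomial_eq_0 del: binomial_Suc_Suc)
    also have "\<dots> = nmul (k ^ Suc j) (p 0) + (\<Sum>i\<le>j. nmul ((j choose Suc i) * k ^ (j - i)) (p (Suc i)))"
      by (subst sum.atMost_Suc_shift) simp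
    finally show ?thesis .
  qed
  have "(((*) (f + nmul k e)) ^^ Suc j) e
      = (f + nmul k e) * (\<Sum>i\<le>j. nmul ((j choose i) * k ^ (j - i)) (p i))"
    by (simp add: Suc p_def)
  also have "\<dots> = (\<Sum>i\<le>j. nmul ((j choose i) * k ^ (j - i)) (p (Suc i)))
      + (\<Sum>i\<le>j. nmul ((j choose i) * k ^ (Suc j - i)) (p i))"
    by (simp add: distrib_right nmul_mult_left mult_nmul_right sum_distrib_left e p_def
        nmul_mult[symmetric] nmul_sum_right nmul_add_right sum.distrib Suc_diff_le mult_ac)
  also have "\<dots> = (\<Sum>i\<le>Suc j. nmul ((Suc j choose i) * k ^ (Suc j - i)) (p i))"
    unfolding shift
    by (subst sum.atMost_Suc_shift) (simp add: sum.distrib[symmetric] nmul_add distrib_right add.assoc add.left_commute)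
  finally show ?case
    by (simp only: p_def)
qed

section \<open>From powers to squares and products\<close>

text \<open>Compare \<open>sq\<close> at \<open>f + g\<close> with \<open>sq\<close> at
  \<open>f\<close> and at \<open>g\<close>: by symmetry of \<open>B\<close>, what remains is twice
  the claim.\<close>

lemma polarize_square_identity:
  assumes tf: "\<And>x::'q. nmul 2 x = 0 \<Longrightarrow> x = 0"
    and P: "is_subring P"
    and T: "additive_on P T"
    and A: "additive_on P A"
    and B: "biadditive B" "\<And>u v. B u v = B v u"
    and sq: "\<And>f. f \<in> P \<Longrightarrow> T (f * f) = nmul 2 (f * T f + B (A f) (A f))"
    and fg: "f \<in> P" "g \<in> P"
  shows "T (f * g) = f * T g + T f * g + nmul 2 (B (A f) (A (g::'q::comm_ring)))"
proof -
  note cl = subring_closed[OF P]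
  have T_add: "T (x + y) = T x + T y" and A_add: "A (x + y) = A x + A y" if "x \<in> P" "y \<in> P" for x y
    using T A that by (auto simp: additive_on_def)
  have B_add: "B (u + v) w = B u w + B v w" "B w (u + v) = B w u + B w v" for u v w
    using B(1) by (auto simp: biadditive_def Modules.additive_def)
  have "(f + g) * (f + g) = f * f + (f * g + (f * g + g * g))"
    by (simp add: algebra_simps)
  then have "T ((f + g) * (f + g)) = T (f * f) + (T (f * g) + (T (f * g) + T (g * g)))"
    using fg by (simp add: T_add cl)
  then have "nmul 2 (T (f * g) - (f * T g + T f * g + nmul 2 (B (A f) (A g)))) = 0"
    using fg sq[OF fg(1)] sq[OF fg(2)] sq[OF cl(4)[OF fg]] B(2)[of "A g" "A f"]
    by (simp add: T_add A_add B_add numeral_2_eq_2 algebra_simps)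
  then show ?thesis
    using tf by fastforce
qed

text \<open>The identity law is used on all of \<open>'q\<close>, since \<open>e\<close> multiplies
  values of \<open>T\<close>, which may lie outside \<open>P\<close>.\<close>

lemma square_identity_if_unit:
  fixes T :: "'q::comm_ring \<Rightarrow> 'q" and A :: "'q \<Rightarrow> 'r::comm_ring"
  assumes n: "n \<ge> 2"
    and torsion: "torsion_free (fact n) TYPE('q)"
    and P: "is_subring P"
    and T: "additive_on P T"
    and A: "additive_on P A"
    and B: "biadditive B"
    and eq: "\<And>f. f \<in> P \<Longrightarrow>
      T (spow f n) = nmul n (spow f (n - 1) * T f) + nmul n (B (A f) (A (spow f (n - 1))))"
    and e: "e \<in> P" "\<And>x::'q. e * x = x" "A e = 0"
    and f: "f \<in> P"
  shows "T (f * f) = nmul 2 (f * T f + B (A f) (A f))"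
proof -
  obtain m where m: "n = Suc (Suc m)"
    using n by (metis add_2_eq_Suc le_Suc_ex)
  note cl = subring_closed[OF P] subring_nmul_closed[OF P]
  have B0: "B 0 v = 0" "B u 0 = 0" for u v
    using B by (auto simp: biadditive_def Modules.additive_def intro: Modules.additive.zero Modules.additive.intro)
  have B_add: "additive_on UNIV (B u)" for u
    using B by (simp add: biadditive_def additive_on_UNIV)
  have pe: "(((*) e) ^^ j) e = e" for j
    by (induction j) (simp_all add: e)
  have "T e = nmul n (T e)"
    using eq[OF e(1)] by (simp add: spow_eq_funpow[OF e(2)] m pe e B0 del: funpow.simps nmul_Suc)
  then have "nmul (Suc m) (T e) = 0"
    by (simp add: m)
  then have Te: "T e = 0"
    by (rule torsion_freeD[OF torsion, rotated]) (auto simp: m intro!: dvd_fact simp del: fact_Suc)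
  define p where "p i = (((*) f) ^^ i) e" for i
  have pP: "p i \<in> P" for i
    by (induction i) (simp_all add: p_def e f cl)
  have p0: "p 0 = e" and p1: "p 1 = f" and p2: "p (Suc 1) = f * f"
    using e(2)[of f] by (simp_all add: p_def mult.commute)
  \<comment> \<open>The bracket on the right of \<open>eq\<close>, with
    \<open>spow f (n - 1)\<close> replaced by \<open>p i\<close>.\<close>
  define q where "q i = p i * T f + B (A f) (A (p i))" for i
  \<comment> \<open>The coefficient of \<open>k ^ (n - 1 - i)\<close> in the difference of both
    sides of \<open>eq\<close> at \<open>f + nmul k e\<close>.\<close>
  define c where "c i = nmul (n choose Suc i) (T (p (Suc i))) - nmul (n * (Suc m choose i)) (q i)" for i
  \<comment> \<open>In degree n - 1 both sides contribute \<open>nmul n (T f)\<close>.\<close>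
  have c0: "c 0 = 0"
    by (simp add: c_def q_def p0 p1[simplified] e B0 del: nmul_Suc)
  \<comment> \<open>The index is reversed so that exponents ascend; the leading coefficient, at
    \<open>j = m\<close>, is \<open>c 1\<close>.\<close>
  have "(\<Sum>j\<le>m. nmul (k ^ j) (c (Suc (m - j)))) = 0" for k
  proof -
    define g where "g = f + nmul k e"
    have gP: "g \<in> P"
      by (simp add: g_def f e cl)
    have sp: "spow g j = (\<Sum>i\<le>j. nmul ((j choose i) * k ^ (j - i)) (p i))" if "j > 0" for j
      using that by (simp add: spow_eq_funpow[OF e(2)] funpow_mult_binomial[OF e(2)] g_def p_def)
    have Tg: "T g = T f"
      using T f e(1) additive_on_nmul[OF P T e(1)]
      by (simp add: g_def additive_on_def cl Te)
    have Ag: "A g = A f"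
      using A f e(1) additive_on_nmul[OF P A e(1)]
      by (simp add: g_def additive_on_def cl e(3))
    have "T (spow g n) = (\<Sum>i\<le>n. nmul ((n choose i) * k ^ (n - i)) (T (p i)))"
      using n by (simp add: sp additive_on_sum_nmul[OF P T pP])
    \<comment> \<open>The term of degree n in \<open>k\<close> is a multiple of
      \<open>T e = 0\<close> and drops out.\<close>
    also have "\<dots> = (\<Sum>i\<le>Suc m. nmul ((n choose Suc i) * k ^ (Suc m - i)) (T (p (Suc i))))"
      by (subst m, subst sum.atMost_Suc_shift) (simp add: m p0 Te)
    finally have l: "T (spow g n) = \<dots>" .
    have "spow g (n - 1) * T g + B (A g) (A (spow g (n - 1)))
        = (\<Sum>i\<le>Suc m. nmul ((Suc m choose i) * k ^ (Suc m - i)) (q i))"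
      by (simp add: m sp additive_on_sum_nmul[OF P A pP] Tg Ag q_def nmul_add_right sum.distrib
          additive_on_sum_nmul[OF is_subring_UNIV B_add] sum_distrib_right nmul_mult_left
          distrib_right del: sum.atMost_Suc nmul_Suc)
    then have r: "T (spow g n) = (\<Sum>i\<le>Suc m. nmul n (nmul ((Suc m choose i) * k ^ (Suc m - i)) (q i)))"
      by (simp only: eq[OF gP] nmul_add_right[symmetric] nmul_sum_right)
    have "0 = (\<Sum>i\<le>Suc m. nmul (k ^ (Suc m - i)) (c i))"
      using l r
      by (simp add: c_def nmul_diff_right sum_subtractf nmul_mult[symmetric] mult_ac
          del: sum.atMost_Suc nmul_Suc)
    also have "\<dots> = (\<Sum>i\<le>m. nmul (k ^ (m - i)) (c (Suc i)))"
      by (subst sum.atMost_Suc_shift) (simp add: c0)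
    also have "\<dots> = (\<Sum>j\<le>m. nmul (k ^ j) (c (Suc (m - j))))"
      by (rule sum.reindex_bij_witness[of _ "\<lambda>j. m - j" "\<lambda>j. m - j"]) auto
    finally show ?thesis by simp
  qed
  then have "nmul (fact m) (c (Suc (m - m))) = 0"
    by (rule nmul_fact_leading_coeff_eq_0)
  \<comment> \<open>The factor 2 prepares for 2 (n - 2)! (\<open>n choose 2\<close>) = n!.\<close>
  then have c1: "nmul (2 * fact m) (c 1) = 0"
    by (simp add: nmul_mult)
  have two: "2 * (n choose 2) = n * Suc m"
    unfolding choose_two m by (simp del: mult_Suc mult_Suc_right)
  \<comment> \<open>Since n (n - 1) is twice \<open>n choose 2\<close>, both terms of
    \<open>c 1\<close> share the factor \<open>n choose 2\<close>.\<close>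
  have "c 1 = nmul (n choose 2) (T (f * f) - nmul 2 (q 1))"
    using p2 two
    by (simp add: c_def nmul_diff_right nmul_mult[symmetric] numeral_2_eq_2 mult.commute del: nmul_Suc)
  moreover have "2 * fact m * (n choose 2) = fact n"
  proof -
    have "2 * fact m * (n choose 2) = fact m * (2 * (n choose 2))"
      by (simp only: mult_ac)
    also have "\<dots> = fact n"
      unfolding two by (simp only: m fact_Suc of_nat_id mult_ac)
    finally show ?thesis .
  qed
  ultimately have "nmul (fact n) (T (f * f) - nmul 2 (q 1)) = 0"
    using c1 by (simp add: nmul_mult[symmetric])
  then have "T (f * f) - nmul 2 (q 1) = 0"
    by (rule torsion_freeD[OF torsion dvd_refl])
  then have "T (f * f) = nmul 2 (q 1)"
    by (simp only: right_minus_eq)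
  then show ?thesis
    by (simp add: q_def p1[simplified])
qed

text \<open>Characteristic zero is the value 0 of \<open>ring_char\<close>, hence the disjunction in
  \<open>char\<close>. The identity occurs only inside the second alternative of \<open>alt\<close>,
  so \<open>n = 2\<close> presupposes none.\<close>

theorem lemma1:
  fixes n :: nat
    and P :: "'q::comm_ring set"
    and T :: "'q \<Rightarrow> 'q"
    and A :: "'q \<Rightarrow> 'r::comm_ring"
    and B :: "'r \<Rightarrow> 'r \<Rightarrow> 'q"
  assumes n: "n \<ge> 2"
    and char: "ring_char TYPE('q) = 0 \<or> ring_char TYPE('q) > fact n"
    and torsion: "torsion_free (fact n) TYPE('q)"
    and P: "is_subring P"
    and T: "additive_on P T"
    and A: "additive_on P A"
    and B_biadditive: "biadditive B"
    and B_symmetric: "\<And>u v. B u v = B v u"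
    and eq: "\<And>f. f \<in> P \<Longrightarrow>
      T (spow f n) = nmul n (spow f (n - 1) * T f) + nmul n (B (A f) (A (spow f (n - 1))))"
    and alt: "n = 2 \<or> (\<exists>e\<in>P. (\<forall>x::'q. e * x = x) \<and> A e = 0)"
  shows "\<forall>f\<in>P. \<forall>g\<in>P. T (f * g) = f * T g + T f * g + nmul 2 (B (A f) (A g))"
proof -
  have sq: "T (f * f) = nmul 2 (f * T f + B (A f) (A f))" if f: "f \<in> P" for f
    using alt
  proof
    \<comment> \<open>Here \<open>spow f (n - 1)\<close> is \<open>f\<close>, so \<open>eq\<close>
      is already the square identity.\<close>
    assume "n = 2"
    then show ?thesis
      using eq[OF f] by (simp add: spow_def nmul_add_right)
  next
    assume "\<exists>e\<in>P. (\<forall>x::'q. e * x = x) \<and> A e = 0"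
    then obtain e where "e \<in> P" "\<And>x::'q. e * x = x" "A e = 0"
      by blast
    from square_identity_if_unit[OF n torsion P T A B_biadditive eq this f]
    show ?thesis .
  qed
  have "(2::nat) dvd fact n"
    using n by (intro dvd_fact) auto
  then have tf: "x = 0" if "nmul 2 x = 0" for x :: 'q
    using torsion_freeD[OF torsion _ that] by simp
  show ?thesis
    using polarize_square_identity[OF tf P T A B_biadditive B_symmetric sq] by blast
qed

end
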